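(* Let $f_1,\dots,f_n\in\Theta$ have pairwise identical or disjoint supports, let $\sigma=\{\sigma_1,\dots,\sigma_p\}$ be the partition of $\{1,\dots,n\}$ in which $j,l$ lie in the same block iff $f_j=f_l$, and $b_k=|\sigma_k|/2$. Then $$\varphi(\omega^{(1)}(f_1)\omega^{(1)}(f_2)\cdots\omega^{(1)}(f_n))=\frac{1}{b_1!b_2!\cdots b_p!}\sum_{\substack{P\in\mathcal{MNC}^2_n\\ P\sim(f_1,\dots,f_n)}}\ \prod_{\{\alpha,\beta\}\in P}\langle f_\alpha,f_\beta\rangle,$$ (the right side being $0$ when $n$ is odd).
   Context: $\mathcal{H}=L^2(\mathbb{R}_+)$, $\Theta=\{\chi_{(s,t]}:0\le s<t<\infty\}$. The monotone Fock space is $\mathcal{F}^{(1)}(\mathcal{H})=\mathbb{C}\Omega\oplus\mathcal{H}\oplus\bigoplus_{n\ge2}L^2(\Delta_n)$, $\Delta_n=\{(x_1,\dots,x_n):x_1>x_2>\cdots>x_n>0\}$, viewed as a subspace of the free Fock space $\mathbb{C}\Omega\oplus\bigoplus_{n\ge1}L^2(\mathbb{R}_+^n)$ with the inherited inner product; $\Omega$ is a unit vector. Let $\mathcal{P}$ be the orthogonal projection of the free Fock space onto it and $g_1\otimes_1\cdots\otimes_1 g_n=\mathcal{P}(g_1\otimes\cdots\otimes g_n)$. The creation operator $a^{(1)}(f)$ is the bounded extension of $\Omega\mapsto f$, $g_1\otimes_1\cdots\otimes_1g_n\mapsto f\otimes_1g_1\otimes_1\cdots\otimes_1g_n$; $a^{(1)*}(f)$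 is its adjoint; $\omega^{(1)}(f)=a^{(1)}(f)+a^{(1)*}(f)$; $\varphi(T)=\langle T\Omega,\Omega\rangle$. Partial order on $\Theta$: $\chi_{(s_1,t_1]}<\chi_{(s_2,t_2]}$ iff $t_1\le s_2$; $f\le g$ iff $f<g$ or $f=g$. An ordered partition of $\{1,\dots,n\}$ is a tuple $P=(P_1,\dots,P_k)$ of pairwise disjoint nonempty blocks with union $\{1,\dots,n\}$ (index $r$ = color of $P_r$). $P\sim(f_1,\dots,f_n)$ (compatible) if $i,j\in P_k\Rightarrow f_i=f_j$ and $i\in P_k,j\in P_l,k<l\Rightarrow f_i\le f_j$. $P$ is non-crossing if there are no $s<r<s'<r'$ with $s,s'\in P_i$, $r,r'\in P_j$, $i\ne j$. $P_i$ is inner w.r.t. $P_j$ (written $P_j<P_i$) if there are $p<q$ in $P_j$ with no element of $P_j$ between them and $p<s<q$ for all $s\in P_i$. $\mathcal{MNC}^2_n$ (monotone non-crossing pair partitions) is the set of ordered non-crossing partitions with all blocks of size two such that $P_j<P_i$ implies $j<i$. *)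

theory Defs
  imports "HOL-Analysis.Analysis"
begin

text \<open>Elements of H are represented by functions real => complex (only values on
  (0,oo) matter).  Inner product, linear in the first argument.\<close>

definition l2_inner :: "(real \<Rightarrow> complex) \<Rightarrow> (real \<Rightarrow> complex) \<Rightarrow> complex" where
  "l2_inner f g = (LINT x:{0<..}|lborel. f x * cnj (g x))"

definition chi :: "real \<Rightarrow> real \<Rightarrow> real \<Rightarrow> complex" where
  "chi s t = (\<lambda>x. indicator {s<..t} x)"

definition Theta :: "(real \<Rightarrow> complex) set" where
  "Theta = {chi s t | s t. 0 \<le> s \<and> s < t}"

definition theta_less :: "(real \<Rightarrow> complex) \<Rightarrow> (real \<Rightarrow> complex) \<Rightarrow> bool" where
  "theta_less f g = (\<exists>s1 t1 s2 t2. 0 \<le> s1 \<and> s1 < t1 \<and> 0 \<le> s2 \<and> s2 < t2 \<and>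
       f = chi s1 t1 \<and> g = chi s2 t2 \<and> t1 \<le> s2)"

definition theta_le :: "(real \<Rightarrow> complex) \<Rightarrow> (real \<Rightarrow> complex) \<Rightarrow> bool" where
  "theta_le f g = (theta_less f g \<or> f = g)"

text \<open>A vector of the free Fock space is a family psi :: nat => real list => complex,
  where psi n is the n-particle component, a function of the list [x_1,...,x_n]
  (psi 0 [] is the vacuum coefficient).\<close>

type_synonym fock = "nat \<Rightarrow> real list \<Rightarrow> complex"

definition vacuum :: fock where
  "vacuum = (\<lambda>n xs. if n = 0 then 1 else 0)"

definition Delta :: "real list set" where
  "Delta = {xs. sorted_wrt (>) xs \<and> (\<forall>x\<in>set xs. 0 < x)}"

definition mono_proj :: "fock \<Rightarrow> fock" where
  "mono_proj psi = (\<lambda>n xs. psi n xs * indicator Delta xs)"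

definition free_tensor :: "(real \<Rightarrow> complex) \<Rightarrow> fock \<Rightarrow> fock" where
  "free_tensor f psi = (\<lambda>n xs. case n of 0 \<Rightarrow> 0 | Suc m \<Rightarrow> f (hd xs) * psi m (tl xs))"

text \<open>Monotone creation operator: a(f) (g_1 \<otimes>_1 ... \<otimes>_1 g_n) = P(f \<otimes> g_1 \<otimes> ... \<otimes> g_n),
  i.e. a(f) psi = P (f \<otimes> psi) on the monotone Fock space.\<close>

definition mono_create :: "(real \<Rightarrow> complex) \<Rightarrow> fock \<Rightarrow> fock" where
  "mono_create f psi = mono_proj (free_tensor f psi)"

text \<open>Its adjoint on the monotone Fock space (the free annihilation operator, which
  maps the monotone Fock space into itself).\<close>

definition mono_annih :: "(real \<Rightarrow> complex) \<Rightarrow> fock \<Rightarrow> fock" where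
  "mono_annih f psi = (\<lambda>n xs. LINT t:{0<..}|lborel. cnj (f t) * psi (Suc n) (t # xs))"

definition mono_omega :: "(real \<Rightarrow> complex) \<Rightarrow> fock \<Rightarrow> fock" where
  "mono_omega f psi = (\<lambda>n xs. mono_create f psi n xs + mono_annih f psi n xs)"

text \<open>Vacuum state phi(T) = <T Omega, Omega>; for T = omega(f_1) ... omega(f_n)
  (indices 1..n of fs) this is the vacuum component of T Omega.\<close>

definition vac_moment :: "(nat \<Rightarrow> real \<Rightarrow> complex) \<Rightarrow> nat \<Rightarrow> complex" where
  "vac_moment fs n = foldr mono_omega (map fs [1..<Suc n]) vacuum 0 []"

text \<open>An ordered partition of {1..n} is a list [P_1,...,P_k] of pairwise disjoint
  nonempty blocks with union {1..n}; the list index is the colour.\<close>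

definition ordered_partition :: "nat \<Rightarrow> nat set list \<Rightarrow> bool" where
  "ordered_partition n P =
     ((\<forall>k<length P. P!k \<noteq> {}) \<and>
      (\<forall>k<length P. \<forall>l<length P. k \<noteq> l \<longrightarrow> P!k \<inter> P!l = {}) \<and>
      \<Union>(set P) = {1..n})"

definition compatible :: "nat set list \<Rightarrow> (nat \<Rightarrow> real \<Rightarrow> complex) \<Rightarrow> bool" where
  "compatible P fs =
     ((\<forall>k<length P. \<forall>i\<in>P!k. \<forall>j\<in>P!k. fs i = fs j) \<and>
      (\<forall>k<length P. \<forall>l<length P. k < l \<longrightarrow> (\<forall>i\<in>P!k. \<forall>j\<in>P!l. theta_le (fs i) (fs j))))"

definition noncrossing :: "nat set list \<Rightarrow> bool" where
  "noncrossing P = (\<not> (\<exists>i<length P. \<exists>j<length P. i \<noteq> j \<and>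
      (\<exists>s r s' r'. s < r \<and> r < s' \<and> s' < r' \<and> s \<in> P!i \<and> s' \<in> P!i \<and> r \<in> P!j \<and> r' \<in> P!j)))"

definition inner_block :: "nat set list \<Rightarrow> nat \<Rightarrow> nat \<Rightarrow> bool" where
  "inner_block P i j = (\<exists>p q. p \<in> P!j \<and> q \<in> P!j \<and> p < q \<and>
      (\<forall>r\<in>P!j. \<not> (p < r \<and> r < q)) \<and> (\<forall>s\<in>P!i. p < s \<and> s < q))"

definition MNC2 :: "nat \<Rightarrow> nat set list set" where
  "MNC2 n = {P. ordered_partition n P \<and> noncrossing P \<and>
      (\<forall>k<length P. card (P!k) = 2) \<and>
      (\<forall>i<length P. \<forall>j<length P. inner_block P i j \<longrightarrow> j < i)}"

end

theory Submission
  imports Defs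
begin

text \<open>Let \<open>f = \<chi>_{(s,t]}\<close> be the letter with the rightmost support. Particles created by \<open>f\<close> sit
  above all others, and an operator of another letter annihilates every vector whose first particle
  lies in the support of \<open>f\<close>. Hence a maximal run \<open>\<omega>(f)^m\<close> acts inside a vacuum moment as the scalar
  \<open>\<phi>(\<omega>(f)^m)\<close>, the \<open>m\<close>-th moment of the arcsine law of variance \<open>t - s\<close>. The ratio of consecutive
  even moments turns this into the recursion
  \<open>(k/2) \<phi>(w) = (t - s) (\<Sum> \<phi>(w'))\<close>, where \<open>k\<close> is the number of letters \<open>f\<close> in \<open>w\<close> and \<open>w'\<close> runs
  over the words obtained from \<open>w\<close> by deleting two adjacent letters \<open>f\<close>.
  On the combinatorial side, the block of highest colour of a compatible monotone pair partition is a
  pair of neighbours carrying the letter \<open>f\<close>; deleting it yields the same recursion without the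
  factor \<open>k/2\<close>, and these factors multiply up to \<open>b_1! ... b_p!\<close>.\<close>

section \<open>Moments of the arcsine law\<close>

text \<open>Equals \<open>binomial (2 * k) k / 2 ^ k\<close>, the coefficient of
  \<open>X ^ k\<close> in the power series of \<open>(1 - 2 X) powr (-1/2)\<close>.\<close>

definition arcsine_coeff :: "nat \<Rightarrow> real" where
  "arcsine_coeff k = (-2) ^ k * ((-1/2) gchoose k)"

definition arcsine_moment :: "nat \<Rightarrow> real \<Rightarrow> real" where
  "arcsine_moment m r = (if even m then arcsine_coeff (m div 2) * r ^ (m div 2) else 0)"

text \<open>The antiderivative of \<open>arcsine_moment m\<close> in \<open>r\<close> that vanishes
  at \<open>0\<close>. It arises when an annihilation operator integrates over the position of the
  first particle.\<close>

definition arcsine_primitive :: "nat \<Rightarrow> real \<Rightarrow> real" where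
  "arcsine_primitive m r =
     (if even m then arcsine_coeff (m div 2) * r ^ Suc (m div 2) / real (Suc (m div 2)) else 0)"

lemma arcsine_coeff_0 [simp]: "arcsine_coeff 0 = 1"
  by (simp add: arcsine_coeff_def)

lemma arcsine_coeff_Suc: "real (Suc k) * arcsine_coeff (Suc k) = real (2 * k + 1) * arcsine_coeff k"
proof -
  have "real (Suc k) * ((-1/2::real) gchoose Suc k) = (-1/2 - real k) * ((-1/2) gchoose k)"
    using gbinomial_mult_1[of "-1/2::real" k] by (simp add: algebra_simps)
  hence "real (Suc k) * arcsine_coeff (Suc k) = (-2) * (-2)^k * ((-1/2 - real k) * ((-1/2) gchoose k))"
    unfolding arcsine_coeff_def by (metis mult.assoc mult.left_commute power_Suc)
  also have "\<dots> = real (2 * k + 1) * arcsine_coeff k"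
    by (simp add: arcsine_coeff_def algebra_simps)
  finally show ?thesis .
qed

text \<open>Compare coefficients in \<open>(1 - 2 X) powr (1/2) * (1 - 2 X) powr (-1/2) = 1\<close>.\<close>
lemma arcsine_coeff_convolution:
  "arcsine_coeff (Suc b) = (\<Sum>a\<le>b. arcsine_coeff a * (arcsine_coeff (b - a) / real (Suc (b - a))))"
proof -
  \<comment> \<open>Up to sign these are the coefficients of positive degree of
    \<open>(1 - 2 X) powr (1/2)\<close>; the absorption identity accounts for the division by
    \<open>Suc j\<close>.\<close>
  have prim: "arcsine_coeff j / real (Suc j) = - ((-2) ^ Suc j * ((1/2) gchoose Suc j))" for j
  proof -
    have "((1/2::real) gchoose Suc j) = (1/2) * ((-1/2) gchoose j) / real (Suc j)"
      using gbinomial_absorption[of j "1/2::real"] by (simp add: field_simps del: of_nat_Suc)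
    thus ?thesis by (simp add: arcsine_coeff_def del: of_nat_Suc)
  qed
  have "(\<Sum>a=0..Suc b. ((-1/2::real) gchoose a) * ((1/2) gchoose (Suc b - a))) = (0::real) gchoose Suc b"
    using gbinomial_Vandermonde[of "-1/2::real" "1/2" "Suc b"] by simp
  hence "(\<Sum>a\<le>Suc b. ((-1/2::real) gchoose a) * ((1/2) gchoose (Suc b - a))) = 0"
    by (simp add: atLeast0AtMost)
  hence "(\<Sum>a\<le>Suc b. (-2) ^ Suc b * (((-1/2::real) gchoose a) * ((1/2) gchoose (Suc b - a)))) = 0"
    by (metis mult_zero_right sum_distrib_left)
  moreover have "(-2) ^ Suc b * (((-1/2::real) gchoose a) * ((1/2) gchoose (Suc b - a))) =
      - (arcsine_coeff a * (arcsine_coeff (b - a) / real (Suc (b - a))))" if "a \<le> b" for a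
  proof -
    have "(-2::real) ^ Suc b = (-2) ^ a * (-2) ^ Suc (b - a)"
      using that by (metis Suc_diff_le le_add_diff_inverse le_SucI power_add)
    thus ?thesis using that unfolding prim by (simp add: arcsine_coeff_def Suc_diff_le)
  qed
  ultimately show ?thesis
    by (simp add: arcsine_coeff_def sum_negf)
qed

lemma arcsine_moment_0 [simp]: "arcsine_moment 0 r = 1"
  by (simp add: arcsine_moment_def)

lemma sum_odd_zero:
  fixes g :: "nat \<Rightarrow> 'a::comm_monoid_add"
  assumes "\<And>j. odd j \<Longrightarrow> g j = 0"
  shows "(\<Sum>j<Suc (2 * b). g j) = (\<Sum>a\<le>b. g (2 * a))"
  by (induction b) (simp_all add: assms add.assoc)

text \<open>For odd \<open>m\<close> this is \<open>arcsine_coeff_convolution\<close> times a power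
  of \<open>r\<close>. For even \<open>m\<close> the indices \<open>j\<close> and
  \<open>m - 1 - j\<close> have opposite parity, so every product vanishes, as does the left
  side.\<close>

lemma arcsine_moment_rec:
  "arcsine_moment (Suc m) r = (\<Sum>j<m. arcsine_primitive (m - 1 - j) r * arcsine_moment j r)"
proof (cases "even m")
  case True
  have "arcsine_primitive (m - 1 - j) r * arcsine_moment j r = 0" if "j < m" for j
    using that True by (auto simp: arcsine_primitive_def arcsine_moment_def)
  hence "(\<Sum>j<m. arcsine_primitive (m - 1 - j) r * arcsine_moment j r) = 0"
    by (intro sum.neutral) blast
  thus ?thesis using True by (simp add: arcsine_moment_def)
next
  case False
  then obtain b where m: "m = Suc (2 * b)" by (auto elim: oddE)
  have "(\<Sum>j<m. arcsine_primitive (m - 1 - j) r * arcsine_moment j r) =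
     (\<Sum>a\<le>b. arcsine_primitive (2 * b - 2 * a) r * arcsine_moment (2 * a) r)"
    unfolding m by (subst sum_odd_zero) (auto simp: arcsine_moment_def)
  also have "\<dots> = (\<Sum>a\<le>b. r ^ Suc b * (arcsine_coeff a * (arcsine_coeff (b - a) / real (Suc (b - a)))))"
  proof (rule sum.cong[OF refl])
    fix a assume "a \<in> {..b}"
    hence "r ^ Suc (b - a) * r ^ a = r ^ Suc b" by (simp flip: power_add)
    moreover have "(2 * b - 2 * a) div 2 = b - a" by simp
    ultimately show "arcsine_primitive (2 * b - 2 * a) r * arcsine_moment (2 * a) r =
      r ^ Suc b * (arcsine_coeff a * (arcsine_coeff (b - a) / real (Suc (b - a))))"
      by (auto simp: arcsine_primitive_def arcsine_moment_def field_simps)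
  qed
  also have "\<dots> = r ^ Suc b * arcsine_coeff (Suc b)"
    by (simp only: arcsine_coeff_convolution sum_distrib_left)
  finally show ?thesis by (simp add: m arcsine_moment_def)
qed

text \<open>Mirrors the counting of deletions: a run of \<open>Suc (Suc m)\<close> equal letters has
  \<open>Suc m\<close> adjacent pairs, and deleting any of them leaves a run of length
  \<open>m\<close>.\<close>

lemma arcsine_moment_ratio:
  "real (Suc (Suc m)) / 2 * arcsine_moment (Suc (Suc m)) r = r * (real (Suc m) * arcsine_moment m r)"
proof (cases "even m")
  case True
  then obtain k where m: "m = 2 * k" by (auto elim: evenE)
  have "real (Suc (Suc m)) / 2 * arcsine_moment (Suc (Suc m)) r =
      (real (Suc k) * arcsine_coeff (Suc k)) * r ^ Suc k"
    by (simp add: m arcsine_moment_def field_simps)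
  thus ?thesis unfolding arcsine_coeff_Suc by (simp add: m arcsine_moment_def algebra_simps)
qed (simp add: arcsine_moment_def)

text \<open>The fundamental theorem of calculus applies on \<open>{y..t}\<close>; the left endpoint
  is then dropped as a null set, to match the half-open support of \<open>chi\<close>.\<close>

lemma integral_arcsine_moment:
  assumes "y \<le> t"
  shows "has_bochner_integral lborel (\<lambda>x. indicator {y<..t} x *\<^sub>R arcsine_moment m (t - x))
           (arcsine_primitive m (t - y))"
proof -
  have "((\<lambda>x. - arcsine_primitive m (t - x)) has_real_derivative arcsine_moment m (t - x)) (at x)" for x
    unfolding arcsine_primitive_def arcsine_moment_def
    by (auto intro!: derivative_eq_intros simp del: power_Suc of_nat_Suc simp: field_simps)
  moreover have "continuous_on {y..t} (\<lambda>x. arcsine_moment m (t - x))"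
    by (cases "even m") (auto simp: arcsine_moment_def intro!: continuous_intros)
  ultimately have "has_bochner_integral lborel (\<lambda>x. indicator {y..t} x *\<^sub>R arcsine_moment m (t - x))
      (- arcsine_primitive m (t - t) - - arcsine_primitive m (t - y))"
    using assms by (intro has_bochner_integral_FTC_Icc)
      (auto intro: has_vector_derivative_at_within simp: has_real_derivative_iff_has_vector_derivative)
  moreover have "arcsine_primitive m 0 = 0" by (simp add: arcsine_primitive_def)
  ultimately have Icc: "has_bochner_integral lborel (\<lambda>x. indicator {y..t} x *\<^sub>R arcsine_moment m (t - x))
      (arcsine_primitive m (t - y))"
    by simp
  have "AE x in lborel. x \<noteq> y" by (rule AE_lborel_singleton)
  hence AE: "AE x in lborel. indicator {y..t} x *\<^sub>R arcsine_moment m (t - x) =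
      indicator {y<..t} x *\<^sub>R arcsine_moment m (t - x)"
    by eventually_elim (auto simp: indicator_def)
  have [measurable]: "(\<lambda>x. arcsine_moment m (t - x)) \<in> borel_measurable borel"
    unfolding arcsine_moment_def by measurable
  show ?thesis
    by (rule has_bochner_integral_cong_AE[THEN iffD1, OF _ _ AE Icc]) measurable
qed

lemma set_integral_arcsine_sum:
  fixes z :: "nat \<Rightarrow> complex"
  assumes "0 \<le> y" "y \<le> t"
    and g: "\<And>x. 0 < x \<Longrightarrow> g x =
      (if y < x \<and> x \<le> t then \<Sum>j<m. of_real (arcsine_moment (m - 1 - j) (t - x)) * z j else 0)"
  shows "(LINT x:{0<..}|lborel. g x) = (\<Sum>j<m. of_real (arcsine_primitive (m - 1 - j) (t - y)) * z j)"
proof -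
  have "has_bochner_integral lborel
      (\<lambda>x. \<Sum>j<m. of_real (indicator {y<..t} x *\<^sub>R arcsine_moment (m - 1 - j) (t - x)) * z j)
      (\<Sum>j<m. of_real (arcsine_primitive (m - 1 - j) (t - y)) * z j)"
    using integral_arcsine_moment[OF assms(2)]
    by (intro has_bochner_integral_sum has_bochner_integral_mult_left has_bochner_integral_of_real) auto
  moreover have "(\<lambda>x. \<Sum>j<m. of_real (indicator {y<..t} x *\<^sub>R arcsine_moment (m - 1 - j) (t - x)) * z j) =
      (\<lambda>x. indicator {0<..} x *\<^sub>R g x)"
    using assms(1) by (auto simp: g indicator_def fun_eq_iff)
  ultimately show ?thesis
    unfolding set_lebesgue_integral_def by (simp add: has_bochner_integral_integral_eq)
qed

section \<open>Runs of the top letter\<close>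

lemma set_integral_eq_0:
  assumes "\<And>x. x \<in> A \<Longrightarrow> g x = (0::complex)"
  shows "(LINT x:A|M. g x) = 0"
  unfolding set_lebesgue_integral_def
  by (rule integral_eq_zero_AE) (auto simp: assms indicator_def)

definition below :: "real \<Rightarrow> (real \<Rightarrow> complex) \<Rightarrow> bool" where
  "below s g \<longleftrightarrow> (\<forall>x>s. g x = 0)"

text \<open>Membership in the monotone Fock space together with a bound on the first, hence largest,
  particle. Values at lists whose length differs from the particle number carry no meaning, so only
  matching lengths are tested.\<close>

definition vec_below :: "real \<Rightarrow> fock \<Rightarrow> bool" where
  "vec_below s psi \<longleftrightarrow> (\<forall>xs x. x # xs \<notin> Delta \<or> s < x \<longrightarrow> psi (Suc (length xs)) (x # xs) = 0)"

text \<open>A relation instead of an equation between vectors, again because only values at lists of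
  matching length are meaningful.\<close>

definition proportional :: "complex \<Rightarrow> fock \<Rightarrow> fock \<Rightarrow> bool" where
  "proportional c psi psi' \<longleftrightarrow> (\<forall>xs. psi (length xs) xs = c * psi' (length xs) xs)"

lemma Nil_in_Delta [simp]: "[] \<in> Delta"
  by (simp add: Delta_def)

lemma Cons_in_Delta: "x # xs \<in> Delta \<longleftrightarrow> 0 < x \<and> (\<forall>y\<in>set xs. y < x) \<and> xs \<in> Delta"
  by (auto simp: Delta_def)

lemma Cons2_in_Delta: "x # y # xs \<in> Delta \<longleftrightarrow> y < x \<and> y # xs \<in> Delta"
  by (auto simp: Delta_def)

lemma mono_create_Nil [simp]: "mono_create f psi 0 [] = 0"
  by (simp add: mono_create_def mono_proj_def free_tensor_def)

lemma mono_create_Cons: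
  "mono_create f psi (Suc n) (x # xs) = (if x # xs \<in> Delta then f x * psi n xs else 0)"
  by (simp add: mono_create_def mono_proj_def free_tensor_def)

lemma vec_below_vacuum: "vec_below s vacuum"
  by (simp add: vec_below_def vacuum_def)

text \<open>For annihilation: if \<open>x # xs\<close> is outside \<open>Delta\<close>, so is
  \<open>y # x # xs\<close>; and if \<open>s < x\<close>, then a list \<open>y # x # xs\<close> in
  \<open>Delta\<close> has \<open>s < y\<close>. Either way the integrand vanishes.\<close>

lemma vec_below_omega:
  assumes "below s g" "vec_below s psi"
  shows "vec_below s (mono_omega g psi)"
proof -
  have "mono_omega g psi (Suc (length xs)) (x # xs) = 0" if "x # xs \<notin> Delta \<or> s < x" for x xs
  proof -
    have "mono_create g psi (Suc (length xs)) (x # xs) = 0"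
      using that assms(1) by (auto simp: mono_create_Cons below_def)
    moreover have "mono_annih g psi (Suc (length xs)) (x # xs) = 0"
      unfolding mono_annih_def
    proof (rule set_integral_eq_0)
      fix y :: real
      have "y # x # xs \<notin> Delta \<or> s < y" using that by (auto simp: Cons2_in_Delta)
      thus "cnj (g y) * psi (Suc (Suc (length xs))) (y # x # xs) = 0"
        using assms(2) unfolding vec_below_def by (metis length_Cons mult_zero_right)
    qed
    ultimately show ?thesis by (simp add: mono_omega_def)
  qed
  thus ?thesis unfolding vec_below_def by blast
qed

lemma vec_below_foldr:
  assumes "\<forall>g\<in>set v. below s g"
  shows "vec_below s (foldr mono_omega v vacuum)"
  using assms by (induction v) (auto intro: vec_below_omega vec_below_vacuum)

lemma proportional_omega:
  assumes "proportional c psi psi'"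
  shows "proportional c (mono_omega g psi) (mono_omega g psi')"
proof -
  have "mono_create g psi (length xs) xs = c * mono_create g psi' (length xs) xs" for xs
    using assms by (cases xs) (auto simp: mono_create_Cons proportional_def)
  moreover have "mono_annih g psi (length xs) xs = c * mono_annih g psi' (length xs) xs" for xs
  proof -
    have "psi (Suc (length xs)) (t # xs) = c * psi' (Suc (length xs)) (t # xs)" for t
      using assms unfolding proportional_def by (metis length_Cons)
    hence "(\<lambda>t. cnj (g t) * psi (Suc (length xs)) (t # xs)) =
        (\<lambda>t. c * (cnj (g t) * psi' (Suc (length xs)) (t # xs)))"
      by (simp add: fun_eq_iff)
    thus ?thesis unfolding mono_annih_def by simp
  qed
  ultimately show ?thesis by (simp add: proportional_def mono_omega_def algebra_simps)
qed

lemma proportional_foldr: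
  "proportional c psi psi' \<Longrightarrow>
    proportional c (foldr mono_omega u psi) (foldr mono_omega u psi')"
  by (induction u) (auto intro: proportional_omega)

section \<open>Powers of \<open>mono_omega (chi s t)\<close> on a vector supported below
  \<open>s\<close>\<close>

context
  fixes s t :: real and psi :: fock
  assumes s: "0 \<le> s" and st: "s < t" and psi: "vec_below s psi"
begin

abbreviation iterated :: "nat \<Rightarrow> fock" where
  "iterated m \<equiv> (mono_omega (chi s t) ^^ m) psi"

lemma chi_eq: "chi s t x = (if s < x \<and> x \<le> t then 1 else 0)"
  by (simp add: chi_def indicator_def)

lemma vec_below_iterated: "vec_below t (iterated m)"
proof (induction m)
  case 0
  thus ?case using psi st by (auto simp: vec_below_def)
next
  case (Suc m)
  thus ?case by (auto intro: vec_below_omega simp: below_def chi_eq)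
qed

lemma iterated_notin_Delta:
  "x # xs \<notin> Delta \<or> t < x \<Longrightarrow> iterated m (Suc (length xs)) (x # xs) = 0"
  using vec_below_iterated by (auto simp: vec_below_def)

text \<open>In the second part the first particle \<open>x\<close> lies in the support of the letter; the operators
  applied after its creation only see the part \<open>(x, t]\<close> of that support.\<close>
lemma iterated_eq:
  shows iterated_low: "xs \<in> Delta \<Longrightarrow> xs = [] \<or> hd xs \<le> s \<Longrightarrow>
      iterated m (length xs) xs = of_real (arcsine_moment m (t - s)) * psi (length xs) xs"
    and iterated_high: "x # xs \<in> Delta \<Longrightarrow> s < x \<Longrightarrow> x \<le> t \<Longrightarrow>
      iterated m (Suc (length xs)) (x # xs) =
        (\<Sum>j<m. of_real (arcsine_moment (m - 1 - j) (t - x)) * iterated j (length xs) xs)"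
\<comment> \<open>The two parts are proved together: under the annihilation integral the first part
  at \<open>m\<close> needs the second at the predecessor of \<open>m\<close>.\<close>
proof (induction m arbitrary: x xs rule: less_induct)
  case (less m)
  {
    case 1
    show ?case
    proof (cases m)
      case (Suc m')
      have annih: "mono_annih (chi s t) (iterated m') (length xs) xs =
        (\<Sum>j<m'. of_real (arcsine_primitive (m' - 1 - j) (t - s)) * iterated j (length xs) xs)"
        unfolding mono_annih_def
      proof (rule set_integral_arcsine_sum)
        fix x :: real assume "0 < x"
        have "x # xs \<in> Delta" if "s < x"
          using 1 that \<open>0 < x\<close> by (cases xs) (auto simp: Cons_in_Delta intro: less_trans)
        thus "cnj (chi s t x) * iterated m' (Suc (length xs)) (x # xs) = (if s < x \<and> x \<le> t
          then \<Sum>j<m'. of_real (arcsine_moment (m' - 1 - j) (t - x)) * iterated j (length xs) xs else 0)"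
          using less.IH(2)[of m' x xs] by (simp add: chi_eq[of x] Suc)
      qed (use s st in auto)
      \<comment> \<open>A created particle would be the head of \<open>xs\<close>, which lies at or
        below \<open>s\<close> and so outside the support of the letter.\<close>
      have "mono_create (chi s t) (iterated m') (length xs) xs = 0"
        using 1 by (cases xs) (auto simp: mono_create_Cons chi_eq)
      hence "iterated m (length xs) xs =
        (\<Sum>j<m'. of_real (arcsine_primitive (m' - 1 - j) (t - s)) * iterated j (length xs) xs)"
        using annih by (simp add: Suc mono_omega_def)
      also have "\<dots> = (\<Sum>j<m'. of_real (arcsine_primitive (m' - 1 - j) (t - s)) *
          (of_real (arcsine_moment j (t - s)) * psi (length xs) xs))"
        by (intro sum.cong refl arg_cong2[where f = "(*)"] less.IH(1)) (use 1 Suc in auto)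
      also have "\<dots> = of_real (arcsine_moment m (t - s)) * psi (length xs) xs"
        by (simp add: Suc arcsine_moment_rec sum_distrib_right mult.assoc)
      finally show ?thesis .
    qed simp
  next
    case 2
    show ?case
    proof (cases m)
      case 0
      thus ?thesis using psi 2 by (simp add: vec_below_def)
    next
      case (Suc m')
      let ?P = "\<lambda>j. complex_of_real (arcsine_primitive j (t - x))"
      let ?D = "\<lambda>j. complex_of_real (arcsine_moment j (t - x))"
      let ?I = "\<lambda>j. iterated j (length xs) xs"
      have "mono_annih (chi s t) (iterated m') (Suc (length xs)) (x # xs) =
        (\<Sum>j<m'. ?P (m' - 1 - j) * iterated j (Suc (length xs)) (x # xs))"
        unfolding mono_annih_def
      proof (rule set_integral_arcsine_sum)
        fix y :: real assume "0 < y"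
        have "y # x # xs \<in> Delta" if "x < y"
          using 2 that by (simp add: Cons2_in_Delta)
        moreover have "iterated m' (Suc (Suc (length xs))) (y # x # xs) = 0" if "\<not> x < y"
          using iterated_notin_Delta[of y "x # xs" m'] that by (simp add: Cons2_in_Delta)
        ultimately show "cnj (chi s t y) * iterated m' (Suc (Suc (length xs))) (y # x # xs) =
          (if x < y \<and> y \<le> t then \<Sum>j<m'. of_real (arcsine_moment (m' - 1 - j) (t - y)) *
              iterated j (Suc (length xs)) (x # xs) else 0)"
          using less.IH(2)[of m' y "x # xs"] 2 by (auto simp: chi_eq[of y] Suc)
      qed (use 2 s in auto)
      also have "\<dots> = (\<Sum>j<m'. ?P (m' - 1 - j) * (\<Sum>b<j. ?D (j - 1 - b) * ?I b))"
        by (intro sum.cong refl arg_cong2[where f = "(*)"] less.IH(2)) (use 2 Suc in auto)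
      also have "\<dots> = (\<Sum>j<m'. \<Sum>b<j. ?P (m' - 1 - j) * ?D (j - 1 - b) * ?I b)"
        by (simp add: sum_distrib_left mult.assoc)
      \<comment> \<open>Exchange of summation over \<open>b < j < m'\<close>, in order to collect
        the coefficient of each \<open>?I b\<close>.\<close>
      also have "\<dots> = (\<Sum>b<m'. \<Sum>j\<in>{Suc b..<m'}. ?P (m' - 1 - j) * ?D (j - 1 - b) * ?I b)"
        by (subst sum.Sigma, simp, simp, subst sum.Sigma, simp, simp,
            rule sum.reindex_bij_witness[where i = "\<lambda>(b, j). (j, b)" and j = "\<lambda>(j, b). (b, j)"]) auto
      also have "\<dots> = (\<Sum>b<m'. ?D (m' - b) * ?I b)"
      proof (rule sum.cong[OF refl])
        fix b assume b: "b \<in> {..<m'}"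
        \<comment> \<open>With \<open>j = a + Suc b\<close> the sum becomes the right side of
          \<open>arcsine_moment_rec\<close> for \<open>m' - Suc b\<close>.\<close>
        have "(\<Sum>j\<in>{Suc b..<m'}. ?P (m' - 1 - j) * ?D (j - 1 - b)) =
            (\<Sum>a<m' - Suc b. ?P (m' - Suc b - 1 - a) * ?D a)"
          by (rule sum.reindex_bij_witness[where i = "\<lambda>a. a + Suc b" and j = "\<lambda>j. j - Suc b"]) auto
        also have "\<dots> = ?D (Suc (m' - Suc b))"
          by (simp add: arcsine_moment_rec)
        also have "Suc (m' - Suc b) = m' - b" using b by auto
        finally show "(\<Sum>j\<in>{Suc b..<m'}. ?P (m' - 1 - j) * ?D (j - 1 - b) * ?I b) = ?D (m' - b) * ?I b"
          by (simp add: sum_distrib_right[symmetric])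
      qed
      \<comment> \<open>The separate term comes from creating \<open>x\<close> in the last
        application. Since \<open>arcsine_moment 0\<close> is \<open>1\<close>, it is the summand
        with index \<open>m'\<close> of the claimed sum.\<close>
      finally have "iterated m (Suc (length xs)) (x # xs) = ?I m' + (\<Sum>b<m'. ?D (m' - b) * ?I b)"
        using 2 by (simp add: Suc mono_omega_def mono_create_Cons chi_eq[of x])
      thus ?thesis by (simp add: Suc)
    qed
  }
qed

text \<open>An operator whose letter lives below \<open>s\<close> only uses values of
  \<open>iterated m\<close> at lists with all entries at or below \<open>s\<close>, and there
  \<open>iterated_low\<close> makes it a multiple of \<open>psi\<close>. For creation, a new
  particle \<open>x \<le> s\<close> forces the remaining ones below \<open>x\<close>.\<close>

lemma iterated_proportional:
  assumes "below s g"
  shows "proportional (of_real (arcsine_moment m (t - s))) (mono_omega g (iterated m)) (mono_omega g psi)"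
proof -
  let ?c = "complex_of_real (arcsine_moment m (t - s))"
  have g: "g x = 0" if "s < x" for x using assms that by (simp add: below_def)
  have "mono_create g (iterated m) (length xs) xs = ?c * mono_create g psi (length xs) xs" for xs
  proof (cases xs)
    case (Cons x ys)
    have "x # ys \<in> Delta \<Longrightarrow> x \<le> s \<Longrightarrow> ys \<in> Delta \<and> (ys = [] \<or> hd ys \<le> s)"
      by (cases ys) (auto simp: Cons_in_Delta)
    thus ?thesis using iterated_low[of ys m] g[of x]
      by (cases "x \<le> s") (auto simp: Cons mono_create_Cons)
  qed simp
  moreover have "mono_annih g (iterated m) (length xs) xs = ?c * mono_annih g psi (length xs) xs" for xs
  proof -
    have "cnj (g x) * iterated m (Suc (length xs)) (x # xs) =
        ?c * (cnj (g x) * psi (Suc (length xs)) (x # xs))" for x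
    proof (cases "x # xs \<in> Delta")
      case True
      thus ?thesis using iterated_low[of "x # xs" m] g[of x] by (cases "x \<le> s") auto
    next
      case False
      thus ?thesis using iterated_notin_Delta[of x xs m] psi by (simp add: vec_below_def)
    qed
    hence "(\<lambda>x. cnj (g x) * iterated m (Suc (length xs)) (x # xs)) =
        (\<lambda>x. ?c * (cnj (g x) * psi (Suc (length xs)) (x # xs)))"
      by (rule ext)
    thus ?thesis unfolding mono_annih_def by simp
  qed
  ultimately show ?thesis by (simp add: proportional_def mono_omega_def algebra_simps)
qed

end

text \<open>The vacuum moment with the word as a list, so that runs and adjacent pairs can be cut
  out by list operations.\<close>

definition word_moment :: "(real \<Rightarrow> complex) list \<Rightarrow> complex" where
  "word_moment w = foldr mono_omega w vacuum 0 []"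

lemma foldr_replicate: "foldr h (replicate m f) z = (h f ^^ m) z"
  by (induction m) auto

text \<open>The rightmost letters act first: \<open>v\<close> prepares a vector below
  \<open>s\<close>, then the run acts, then the last letter of \<open>u\<close>, which only sees a
  scalar multiple. If \<open>u\<close> is empty, the vacuum component itself is covered by
  \<open>iterated_low\<close>.\<close>

lemma word_moment_run:
  assumes "0 \<le> s" "s < t" "\<forall>g\<in>set v. below s g" "u = [] \<or> below s (last u)"
  shows "word_moment (u @ replicate m (chi s t) @ v) =
    of_real (arcsine_moment m (t - s)) * word_moment (u @ v)"
proof -
  define psi where "psi = foldr mono_omega v vacuum"
  have psi: "vec_below s psi" unfolding psi_def by (rule vec_below_foldr) fact
  show ?thesis
  proof (cases u rule: rev_cases)
    case Nil
    thus ?thesis using iterated_low[OF assms(1,2) psi, of "[]" m]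
      by (simp add: word_moment_def psi_def foldr_replicate)
  next
    case (snoc u' g)
    hence "below s g" using assms(4) by simp
    from proportional_foldr[OF iterated_proportional[OF assms(1,2) psi this], of m u']
    have "proportional (of_real (arcsine_moment m (t - s)))
        (foldr mono_omega (u @ replicate m (chi s t) @ v) vacuum) (foldr mono_omega (u @ v) vacuum)"
      by (simp add: snoc psi_def foldr_replicate)
    thus ?thesis unfolding word_moment_def proportional_def by (metis list.size(3))
  qed
qed

section \<open>Deleting adjacent pairs in words\<close>

text \<open>A list and not a set, because deletions at different positions can give the same word
  and must be counted separately.\<close>

fun pair_removals :: "'a \<Rightarrow> 'a list \<Rightarrow> 'a list list" where
  "pair_removals f [] = []"
| "pair_removals f (x # xs) =
     (if x = f \<and> xs \<noteq> [] \<and> hd xs = f then [tl xs] else []) @ map ((#) x) (pair_removals f xs)"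

lemma pair_removals_notin: "f \<notin> set v \<Longrightarrow> pair_removals f v = []"
  by (induction v) auto

text \<open>The condition on \<open>u\<close> excludes a pair straddling the cut.\<close>

lemma pair_removals_append:
  "u = [] \<or> last u \<noteq> f \<Longrightarrow>
    pair_removals f (u @ v) = map (\<lambda>u'. u' @ v) (pair_removals f u) @ map ((@) u) (pair_removals f v)"
proof (induction u)
  case (Cons x u)
  show ?case
  proof (cases "u = []")
    case False
    thus ?thesis using Cons by (auto simp: o_def)
  qed (use Cons in auto)
qed (simp add: map_idI)

lemma pair_removals_run:
  assumes "f \<notin> set v"
  shows "pair_removals f (replicate (Suc m) f @ v) = replicate m (replicate (m - 1) f @ v)"
proof (induction m)
  case 0
  show ?case using assms pair_removals_notin[OF assms] by (cases v) auto
next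
  case (Suc m)
  have "pair_removals f (replicate (Suc (Suc m)) f @ v) =
      (replicate m f @ v) # map ((#) f) (pair_removals f (replicate (Suc m) f @ v))"
    by simp
  also have "\<dots> = (replicate m f @ v) # replicate m (f # replicate (m - 1) f @ v)"
    unfolding Suc.IH by simp
  also have "\<dots> = replicate (Suc m) (replicate (Suc m - 1) f @ v)"
    by (cases m) auto
  finally show ?case .
qed

text \<open>Ensures that a prefix not ending in \<open>f\<close> still satisfies the hypothesis of
  \<open>word_moment_run\<close> after a deletion.\<close>

lemma pair_removals_last:
  "w \<in> set (pair_removals f u) \<Longrightarrow> last u \<noteq> f \<Longrightarrow> w \<noteq> [] \<and> last w = last u"
proof (induction u arbitrary: w)
  case (Cons x u)
  from Cons.prems(1) consider (hd) "u \<noteq> []" "hd u = f" "w = tl u"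
    | (tl) w' where "w' \<in> set (pair_removals f u)" "w = x # w'"
    by (auto split: if_splits)
  thus ?case
  proof cases
    case hd
    then obtain z where "u = f # z" by (cases u) auto
    thus ?thesis using hd Cons.prems(2) by (auto split: if_splits)
  next
    case tl
    hence "u \<noteq> []" by auto
    thus ?thesis using tl Cons.IH[OF tl(1)] Cons.prems(2) by auto
  qed
qed simp

lemma pair_removals_set: "w \<in> set (pair_removals f u) \<Longrightarrow> set w \<subseteq> set u"
proof (induction u arbitrary: w)
  case (Cons x u)
  from Cons.prems consider "w = tl u" "u \<noteq> []" | w' where "w' \<in> set (pair_removals f u)" "w = x # w'"
    by (auto split: if_splits)
  thus ?case
  proof cases
    case 1
    thus ?thesis by (cases u) auto
  next
    case 2
    thus ?thesis using Cons.IH by fastforce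
  qed
qed simp

lemma split_last_run:
  assumes "f \<in> set w"
  obtains u m v where "w = u @ replicate (Suc m) f @ v" "f \<notin> set v" "u = [] \<or> last u \<noteq> f"
proof -
  obtain a v where w: "w = a @ f # v" "f \<notin> set v"
    using assms by (metis split_list_last)
  \<comment> \<open>Reversal makes the copies of \<open>f\<close> at the end of \<open>a\<close> an
    initial segment; they join the last \<open>f\<close> to form the maximal run.\<close>
  define b where "b = takeWhile (\<lambda>x. x = f) (rev a)"
  define c where "c = dropWhile (\<lambda>x. x = f) (rev a)"
  have "\<forall>x\<in>set b. x = f" by (auto simp: b_def dest: set_takeWhileD)
  hence b: "b = replicate (length b) f" by (simp add: replicate_length_same)
  have "rev a = b @ c" by (simp add: b_def c_def)
  hence "a = rev c @ rev b" by (metis rev_append rev_rev_ident)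
  moreover have "rev b = replicate (length b) f" using b by (metis rev_replicate)
  ultimately have "w = rev c @ replicate (Suc (length b)) f @ v"
    using w by (simp add: replicate_app_Cons_same)
  moreover have "rev c = [] \<or> last (rev c) \<noteq> f"
    using hd_dropWhile[of "\<lambda>x. x = f" "rev a"] by (auto simp: c_def last_rev)
  ultimately show ?thesis using that w(2) by blast
qed

text \<open>Induction over the runs of the top letter: the rightmost run can be split off as a factor.\<close>
lemma word_moment_pair_removals:
  assumes "0 \<le> s" "s < t" "\<forall>g\<in>set w. g = chi s t \<or> below s g"
  shows "of_nat (count_list w (chi s t)) / 2 * word_moment w =
    of_real (t - s) * sum_list (map word_moment (pair_removals (chi s t) w))"
  using assms(3)
proof (induction "count_list w (chi s t)" arbitrary: w rule: less_induct)
  case less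
  let ?f = "chi s t"
  let ?D = "\<lambda>m. complex_of_real (arcsine_moment m (t - s))"
  show ?case
  proof (cases "?f \<in> set w")
    case False
    thus ?thesis by (simp add: pair_removals_notin count_list_0_iff)
  next
    case True
    then obtain u m v where w: "w = u @ replicate (Suc m) ?f @ v" "?f \<notin> set v" "u = [] \<or> last u \<noteq> ?f"
      by (rule split_last_run)
    have v: "\<forall>g\<in>set v. below s g"
      using w(2) less.prems unfolding w(1) by (metis Un_iff set_append)
    \<comment> \<open>The prefix varies because deletions may occur inside \<open>u\<close>, the
      exponent because they may occur inside the run.\<close>
    have run: "word_moment (u' @ replicate k ?f @ v) = ?D k * word_moment (u' @ v)"
      if "u' = [] \<or> last u' \<noteq> ?f" "set u' \<subseteq> set u" for u' k
      using that w less.prems by (intro word_moment_run assms v) (auto dest: last_in_set)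
    have "count_list (replicate k ?f) ?f = k" for k by (induction k) auto
    hence count: "count_list w ?f = count_list u ?f + Suc m" "count_list (u @ v) ?f = count_list u ?f"
      using w(2) by (simp_all add: w(1) count_list_append count_list_0_iff)
    have "\<forall>g\<in>set (u @ v). g = ?f \<or> below s g" using less.prems unfolding w(1) set_append by blast
    hence IH: "of_nat (count_list u ?f) / 2 * word_moment (u @ v) =
        of_real (t - s) * (\<Sum>u'\<leftarrow>pair_removals ?f u. word_moment (u' @ v))"
      using less.hyps[of "u @ v"] w(2,3)
      by (simp add: count pair_removals_append pair_removals_notin o_def)
    have u': "word_moment (u' @ replicate (Suc m) ?f @ v) = ?D (Suc m) * word_moment (u' @ v)"
      if "u' \<in> set (pair_removals ?f u)" for u'
      using that w(3) by (intro run pair_removals_set) (auto dest: pair_removals_last)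
    \<comment> \<open>No pair meets both \<open>u\<close> and the run, so a deletion happens inside
      \<open>u\<close> or in one of the \<open>m\<close> adjacent pairs of the run.\<close>
    have "map word_moment (pair_removals ?f w) =
        map (\<lambda>u'. word_moment (u' @ replicate (Suc m) ?f @ v)) (pair_removals ?f u) @
        replicate m (word_moment (u @ replicate (m - 1) ?f @ v))"
      unfolding w(1) pair_removals_append[OF w(3)] pair_removals_run[OF w(2)] by (simp add: o_def)
    also have "map (\<lambda>u'. word_moment (u' @ replicate (Suc m) ?f @ v)) (pair_removals ?f u) =
        map (\<lambda>u'. ?D (Suc m) * word_moment (u' @ v)) (pair_removals ?f u)"
      using u' by simp
    finally have "of_real (t - s) * sum_list (map word_moment (pair_removals ?f w)) =
        ?D (Suc m) * (of_real (t - s) * (\<Sum>u'\<leftarrow>pair_removals ?f u. word_moment (u' @ v))) +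
        of_real (t - s) * of_nat m * word_moment (u @ replicate (m - 1) ?f @ v)"
      by (simp add: sum_list_const_mult sum_list_replicate distrib_left mult.assoc mult.left_commute
          del: of_real_diff)
    also have "\<dots> = ?D (Suc m) * (of_nat (count_list u ?f) / 2 * word_moment (u @ v)) +
        of_real ((t - s) * (of_nat m * arcsine_moment (m - 1) (t - s))) * word_moment (u @ v)"
      using run[OF w(3) subset_refl] unfolding IH[symmetric] by simp
    \<comment> \<open>For \<open>m = 0\<close> both sides vanish, the right one because the first
      moment is zero; otherwise this is \<open>arcsine_moment_ratio\<close>.\<close>
    also have "(t - s) * (of_nat m * arcsine_moment (m - 1) (t - s)) =
        real (Suc m) / 2 * arcsine_moment (Suc m) (t - s)"
    proof (cases m)
      case (Suc k)
      thus ?thesis using arcsine_moment_ratio[of k "t - s"] by simp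
    qed (simp add: arcsine_moment_def)
    also have "?D (Suc m) * (of_nat (count_list u ?f) / 2 * word_moment (u @ v)) +
        of_real (real (Suc m) / 2 * arcsine_moment (Suc m) (t - s)) * word_moment (u @ v) =
        of_nat (count_list w ?f) / 2 * (?D (Suc m) * word_moment (u @ v))"
      by (simp add: count field_simps)
    also have "?D (Suc m) * word_moment (u @ v) = word_moment w"
      using run[OF w(3) subset_refl, of "Suc m"] w(1) by simp
    finally show ?thesis by simp
  qed
qed

text \<open>Passes from recursively generated deletions to positions, the form in which the
  partition side produces its sum.\<close>

lemma sum_list_pair_removals:
  fixes h :: "'a list \<Rightarrow> 'b::comm_monoid_add"
  shows "sum_list (map h (pair_removals f w)) =
    (\<Sum>i | Suc i < length w \<and> w ! i = f \<and> w ! Suc i = f. h (take i w @ drop (Suc (Suc i)) w))"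
proof (induction w arbitrary: h)
  case (Cons x w)
  let ?S = "\<lambda>w. {i. Suc i < length w \<and> w ! i = f \<and> w ! Suc i = f}"
  let ?A = "if x = f \<and> w \<noteq> [] \<and> hd w = f then {0::nat} else {}"
  have fin: "finite (?S w)" by (rule finite_subset[of _ "{..<length w}"]) auto
  have "?S (x # w) = ?A \<union> Suc ` ?S w"
  proof (intro set_eqI iffI)
    fix i assume "i \<in> ?S (x # w)"
    thus "i \<in> ?A \<union> Suc ` ?S w" by (cases i) (auto simp: hd_conv_nth)
  qed (auto simp: hd_conv_nth split: if_splits)
  hence "(\<Sum>i\<in>?S (x # w). h (take i (x # w) @ drop (Suc (Suc i)) (x # w))) =
      (\<Sum>i\<in>?A. h (take i (x # w) @ drop (Suc (Suc i)) (x # w))) +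
      (\<Sum>i\<in>Suc ` ?S w. h (take i (x # w) @ drop (Suc (Suc i)) (x # w)))"
    using fin by (simp only:) (rule sum.union_disjoint, auto)
  also have "\<dots> = (if x = f \<and> w \<noteq> [] \<and> hd w = f then h (tl w) else 0) +
      (\<Sum>i\<in>?S w. h (x # take i w @ drop (Suc (Suc i)) w))"
    by (subst sum.reindex) (auto simp: drop_Suc)
  finally show ?case using Cons[of "\<lambda>w. h (x # w)"] by (simp add: o_def)
qed simp

section \<open>Deleting the block of highest colour\<close>

text \<open>The increasing enumeration of all naturals other than \<open>i\<close> and
  \<open>Suc i\<close>; it relabels a smaller partition to make room for this pair.\<close>

definition skip :: "nat \<Rightarrow> nat \<Rightarrow> nat" where
  "skip i j = (if j < i then j else j + 2)"

lemma strict_mono_skip: "strict_mono (skip i)"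
  by (auto simp: strict_mono_def skip_def)

lemma skip_less_iff [simp]: "skip i a < skip i b \<longleftrightarrow> a < b"
  by (rule strict_mono_less[OF strict_mono_skip])

lemma inj_skip: "inj (skip i)"
  by (rule strict_mono_imp_inj_on[OF strict_mono_skip])

lemma range_skip: "range (skip i) = - {i, Suc i}"
proof (intro set_eqI iffI)
  fix x assume x: "x \<in> - {i, Suc i}"
  show "x \<in> range (skip i)"
  proof (cases "x < i")
    case True
    thus ?thesis by (intro image_eqI[of _ _ x]) (auto simp: skip_def)
  next
    case False
    thus ?thesis using x by (intro image_eqI[of _ _ "x - 2"]) (auto simp: skip_def)
  qed
qed (auto simp: skip_def split: if_splits)

lemma skip_image_interval:
  assumes "1 \<le> i" "Suc i \<le> n"
  shows "skip i ` {1..n - 2} = {1..n} - {i, Suc i}"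
proof -
  have in_range: "skip i j \<in> {1..n} \<longleftrightarrow> j \<in> {1..n - 2}" for j
    using assms by (auto simp: skip_def)
  show ?thesis
  proof (intro set_eqI iffI)
    fix x assume x: "x \<in> {1..n} - {i, Suc i}"
    hence "x \<in> range (skip i)" unfolding range_skip by simp
    then obtain j where "x = skip i j" by (rule rangeE)
    thus "x \<in> skip i ` {1..n - 2}" using x in_range[of j] by blast
  next
    fix x assume "x \<in> skip i ` {1..n - 2}"
    then obtain j where j: "x = skip i j" "j \<in> {1..n - 2}" by blast
    hence "x \<in> range (skip i)" "x \<in> {1..n}" using in_range by blast+
    thus "x \<in> {1..n} - {i, Suc i}" unfolding range_skip by simp
  qed
qed

text \<open>Inverse of deleting the block of highest colour: the new pair is appended at the end of
  the list of blocks.\<close>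

definition insert_pair :: "nat \<Rightarrow> nat set list \<Rightarrow> nat set list" where
  "insert_pair i P = map ((`) (skip i)) P @ [{i, Suc i}]"

lemma length_insert_pair [simp]: "length (insert_pair i P) = Suc (length P)"
  by (simp add: insert_pair_def)

lemma nth_insert_pair [simp]:
  "k < length P \<Longrightarrow> insert_pair i P ! k = skip i ` (P ! k)"
  "insert_pair i P ! length P = {i, Suc i}"
  by (simp_all add: insert_pair_def nth_append)

lemma skip_notin [simp]: "skip i a \<noteq> i" "skip i a \<noteq> Suc i"
  by (auto simp: skip_def)

lemma insert_pair_inj: "insert_pair i P = insert_pair j Q \<longleftrightarrow> i = j \<and> P = Q"
proof -
  have "inj (map ((`) (skip i)))"
    by (intro inj_mapI injI) (simp add: inj_image_eq_iff[OF inj_skip])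
  thus ?thesis by (auto simp: insert_pair_def doubleton_eq_iff inj_eq)
qed

lemma all_less_insert_pair:
  "(\<forall>k<length (insert_pair i P). Q k) \<longleftrightarrow> (\<forall>k<length P. Q k) \<and> Q (length P)"
  by (auto simp: less_Suc_eq)

lemma ordered_partition_insert_pair:
  assumes "1 \<le> i" "Suc i \<le> n"
  shows "ordered_partition n (insert_pair i P) \<longleftrightarrow> ordered_partition (n - 2) P"
proof -
  have dis: "skip i ` A \<inter> skip i ` B = {} \<longleftrightarrow> A \<inter> B = {}" for A B
    using image_Int[OF inj_skip, of i A B] by blast
  have dis2: "skip i ` A \<inter> {i, Suc i} = {}" "{i, Suc i} \<inter> skip i ` A = {}" for A
    by (auto dest: sym)
  have "\<Union> (set (insert_pair i P)) = skip i ` \<Union> (set P) \<union> {i, Suc i}"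
    by (auto simp: insert_pair_def)
  moreover have "{1..n} = skip i ` {1..n - 2} \<union> {i, Suc i}"
    unfolding skip_image_interval[OF assms] using assms by auto
  ultimately have "\<Union> (set (insert_pair i P)) = {1..n} \<longleftrightarrow>
      skip i ` \<Union> (set P) \<union> {i, Suc i} = skip i ` {1..n - 2} \<union> {i, Suc i}"
    by simp
  also have "\<dots> \<longleftrightarrow> skip i ` \<Union> (set P) = skip i ` {1..n - 2}"
    using dis2 by blast
  also have "\<dots> \<longleftrightarrow> \<Union> (set P) = {1..n - 2}"
    by (rule inj_image_eq_iff[OF inj_skip])
  finally have un: "\<Union> (set (insert_pair i P)) = {1..n} \<longleftrightarrow> \<Union> (set P) = {1..n - 2}" .
  show ?thesis
    unfolding ordered_partition_def un all_less_insert_pair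
    by (simp add: dis dis2 less_imp_neq cong: conj_cong)
qed

lemma noncrossing_insert_pair: "noncrossing (insert_pair i P) \<longleftrightarrow> noncrossing P"
proof -
  show ?thesis (is "?L = ?R")
  proof
    assume L: ?L
    show ?R
      unfolding noncrossing_def
    proof safe
      fix a b s r s' r'
      assume "a < length P" "b < length P" "a \<noteq> b" "s < r" "r < s'" "s' < r'"
        "s \<in> P ! a" "s' \<in> P ! a" "r \<in> P ! b" "r' \<in> P ! b"
      hence "a < length (insert_pair i P) \<and> b < length (insert_pair i P) \<and> a \<noteq> b \<and>
        skip i s < skip i r \<and> skip i r < skip i s' \<and> skip i s' < skip i r' \<and>
        skip i s \<in> insert_pair i P ! a \<and> skip i s' \<in> insert_pair i P ! a \<and>
        skip i r \<in> insert_pair i P ! b \<and> skip i r' \<in> insert_pair i P ! b" by simp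
      thus False using L unfolding noncrossing_def by blast
    qed
  next
    assume R: ?R
    show ?L
      unfolding noncrossing_def
    proof safe
      fix a b s r s' r'
      assume *: "a < length (insert_pair i P)" "b < length (insert_pair i P)" "a \<noteq> b"
        "s < r" "r < s'" "s' < r'" "s \<in> insert_pair i P ! a" "s' \<in> insert_pair i P ! a"
        "r \<in> insert_pair i P ! b" "r' \<in> insert_pair i P ! b"
      \<comment> \<open>A crossing needs a number strictly between the two elements of each block,
        and the new block consists of neighbours.\<close>
      have "a \<noteq> length P" "b \<noteq> length P" using * by auto
      hence ab: "a < length P" "b < length P" using * by auto
      then obtain s0 r0 s0' r0' where "s = skip i s0" "r = skip i r0" "s' = skip i s0'" "r' = skip i r0'"
        "s0 \<in> P ! a" "s0' \<in> P ! a" "r0 \<in> P ! b" "r0' \<in> P ! b" using * by auto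
      thus False using R * ab unfolding noncrossing_def by (metis skip_less_iff)
    qed
  qed
qed

lemma inner_block_insert_pair:
  assumes "a < length P" "b < length P"
  shows "inner_block (insert_pair i P) a b \<longleftrightarrow> inner_block P a b"
  using assms by (simp add: inner_block_def) blast

text \<open>Nothing fits inside the new pair, and its own nesting inside other blocks is harmless
  because it has the highest colour.\<close>

lemma MNC2_insert_pair:
  assumes "1 \<le> i" "Suc i \<le> n"
  shows "insert_pair i P \<in> MNC2 n \<longleftrightarrow> P \<in> MNC2 (n - 2)"
proof -
  have card: "(\<forall>k<length (insert_pair i P). card (insert_pair i P ! k) = 2) \<longleftrightarrow>
      (\<forall>k<length P. card (P ! k) = 2)"
    unfolding all_less_insert_pair by (simp add: card_image inj_on_subset[OF inj_skip])
  \<comment> \<open>Nonemptiness matters here: an empty block would count vacuously as inner to the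
    new pair.\<close>
  have "\<not> inner_block (insert_pair i P) a (length P)"
    if "a < length P" "P ! a \<noteq> {}" for a
    using that by (fastforce simp: inner_block_def)
  moreover have "\<not> inner_block (insert_pair i P) (length P) (length P)"
    by (auto simp: inner_block_def)
  ultimately have inner: "(\<forall>a<length (insert_pair i P). \<forall>b<length (insert_pair i P).
        inner_block (insert_pair i P) a b \<longrightarrow> b < a) \<longleftrightarrow>
      (\<forall>a<length P. \<forall>b<length P. inner_block P a b \<longrightarrow> b < a)" if "ordered_partition (n - 2) P"
    using that unfolding all_less_insert_pair ordered_partition_def
    by (auto simp: inner_block_insert_pair)
  show ?thesis
    unfolding MNC2_def mem_Collect_eq ordered_partition_insert_pair[OF assms] noncrossing_insert_pair card
    using inner by blast
qed

text \<open>If the last block \<open>{p, q}\<close> had a gap, the block of \<open>Suc p\<close>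
  would lie between \<open>p\<close> and \<open>q\<close> by the absence of crossings. It would then
  be inner to the last block and need a still higher colour.\<close>

lemma MNC2_last_block:
  assumes P: "P \<in> MNC2 n" and "0 < n"
  obtains i Q where "P = insert_pair i Q" "1 \<le> i" "Suc i \<le> n"
proof -
  have op: "ordered_partition n P" and nc: "noncrossing P"
    and card: "\<And>k. k < length P \<Longrightarrow> card (P ! k) = 2"
    and inner: "\<And>a b. a < length P \<Longrightarrow> b < length P \<Longrightarrow> inner_block P a b \<Longrightarrow> b < a"
    using P by (auto simp: MNC2_def)
  have dis: "\<And>k l. k < length P \<Longrightarrow> l < length P \<Longrightarrow> k \<noteq> l \<Longrightarrow> P ! k \<inter> P ! l = {}"
    and un: "\<Union> (set P) = {1..n}"
    using op by (auto simp: ordered_partition_def)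
  have "P \<noteq> []" using un \<open>0 < n\<close> by auto
  define m where "m = length P - 1"
  have m: "m < length P" and len: "length P = Suc m" using \<open>P \<noteq> []\<close> by (auto simp: m_def)
  obtain p q where pq: "P ! m = {p, q}" "p < q"
    using card[OF m] by (metis card_2_iff insert_commute linorder_neqE_nat)
  have sub: "P ! m \<subseteq> {1..n}" using un m nth_mem by blast
  have q: "q = Suc p"
  proof (rule ccontr)
    assume "q \<noteq> Suc p"
    hence "Suc p < q" using pq by auto
    hence "Suc p \<in> {1..n}" using sub pq by auto
    then obtain k where k: "k < length P" "Suc p \<in> P ! k"
      using un by (metis UnionE in_set_conv_nth)
    have "k \<noteq> m" using k pq \<open>Suc p < q\<close> by auto
    then obtain r where r: "P ! k = {Suc p, r}" "r \<noteq> Suc p"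
      using card[OF k(1)] k(2) by (metis card_2_iff doubleton_eq_iff insertE singletonD)
    have "r \<noteq> p" "r \<noteq> q" using dis[OF k(1) m \<open>k \<noteq> m\<close>] r pq by auto
    have "\<not> q < r"
    proof
      assume "q < r"
      hence "p < Suc p \<and> Suc p < q \<and> q < r \<and> p \<in> P ! m \<and> q \<in> P ! m \<and> Suc p \<in> P ! k \<and> r \<in> P ! k"
        using \<open>Suc p < q\<close> pq r by auto
      thus False using nc m k \<open>k \<noteq> m\<close> unfolding noncrossing_def by metis
    qed
    moreover have "\<not> r < p"
    proof
      assume "r < p"
      hence "r < p \<and> p < Suc p \<and> Suc p < q \<and> r \<in> P ! k \<and> Suc p \<in> P ! k \<and> p \<in> P ! m \<and> q \<in> P ! m"
        using \<open>Suc p < q\<close> pq r by auto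
      thus False using nc m k \<open>k \<noteq> m\<close> unfolding noncrossing_def by metis
    qed
    ultimately have "p < r" "r < q" using \<open>r \<noteq> p\<close> \<open>r \<noteq> q\<close> by auto
    hence "inner_block P k m" using pq r \<open>Suc p < q\<close> unfolding inner_block_def
      by (intro exI[of _ p] exI[of _ q]) auto
    thus False using inner[OF k(1) m] k len by auto
  qed
  \<comment> \<open>The other blocks avoid \<open>p\<close> and \<open>Suc p\<close>, so they lie in
    the range of \<open>skip p\<close> and are recovered from their preimages.\<close>
  define Q where "Q = map ((-`) (skip p)) (butlast P)"
  have "skip p ` (skip p -` B) = B" if "B \<in> set (butlast P)" for B
  proof -
    from that obtain k where k: "k < m" "B = P ! k"
      by (auto simp: in_set_conv_nth nth_butlast len)
    hence "B \<inter> {p, Suc p} = {}" using dis[of k m] m pq q by auto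
    thus ?thesis using range_skip[of p] by auto
  qed
  hence "map ((`) (skip p)) Q = butlast P" by (simp add: Q_def map_idI)
  moreover have "last P = {p, Suc p}" using pq q \<open>P \<noteq> []\<close> by (simp add: last_conv_nth m_def)
  ultimately have "P = insert_pair p Q"
    using append_butlast_last_id[OF \<open>P \<noteq> []\<close>] by (simp add: insert_pair_def)
  thus ?thesis using that sub pq q by auto
qed

text \<open>Nonempty disjoint blocks are distinct, which bounds the number of colours.\<close>

lemma finite_MNC2: "finite (MNC2 n)"
proof (rule finite_subset)
  show "MNC2 n \<subseteq> {P. set P \<subseteq> Pow {1..n} \<and> length P \<le> card (Pow {1..n})}"
  proof
    fix P assume "P \<in> MNC2 n"
    hence P: "ordered_partition n P" by (simp add: MNC2_def)
    hence "distinct P" unfolding ordered_partition_def distinct_conv_nth by (metis Int_absorb)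
    moreover have "set P \<subseteq> Pow {1..n}" using P unfolding ordered_partition_def by blast
    ultimately show "P \<in> {P. set P \<subseteq> Pow {1..n} \<and> length P \<le> card (Pow {1..n})}"
      by (metis (mono_tags, lifting) card_mono distinct_card finite_Pow_iff finite_atLeastAtMost mem_Collect_eq)
  qed
qed (rule finite_lists_length_le, simp)

section \<open>Compatibility and the recursion for the sum over partitions\<close>

lemma theta_le_chi_below:
  assumes "0 \<le> s" "s < t" "g \<in> Theta" "below s g"
  shows "theta_le g (chi s t)"
proof -
  obtain a b where g: "g = chi a b" "0 \<le> a" "a < b" using assms(3) by (auto simp: Theta_def)
  have "g b \<noteq> 0" using g by (simp add: chi_def)
  hence "b \<le> s" using assms(4) by (force simp: below_def)
  thus ?thesis using g assms(1,2) unfolding theta_le_def theta_less_def by blast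
qed

lemma not_theta_le_chi_below:
  assumes "s < t" "below s g" "g \<noteq> chi s t"
  shows "\<not> theta_le (chi s t) g"
proof
  assume "theta_le (chi s t) g"
  then obtain s1 t1 s2 t2 where h: "s1 < t1" "s2 < t2" "chi s t = chi s1 t1" "g = chi s2 t2" "t1 \<le> s2"
    using assms(3) by (auto simp: theta_le_def theta_less_def)
  have "g t2 \<noteq> 0" using h by (simp add: chi_def)
  hence "t2 \<le> s" using assms(2) by (force simp: below_def)
  \<comment> \<open>The endpoints supplied by \<open>theta_less\<close> are only known through
    equality of functions, so they are compared by evaluating at right endpoints, which belong to
    the supports.\<close>
  have "chi s1 t1 t \<noteq> 0" using assms(1) unfolding h(3)[symmetric] by (simp add: chi_def)
  hence "t \<le> t1" by (auto simp: chi_def indicator_def split: if_splits)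
  thus False using h \<open>t2 \<le> s\<close> assms(1) by linarith
qed

lemma compatible_insert_pair:
  "compatible (insert_pair i P) fs \<longleftrightarrow> compatible P (fs \<circ> skip i) \<and> fs i = fs (Suc i) \<and>
     (\<forall>k<length P. \<forall>a\<in>P ! k. theta_le (fs (skip i a)) (fs i) \<and> theta_le (fs (skip i a)) (fs (Suc i)))"
proof -
  let ?R = "insert_pair i P"
  have same: "(\<forall>k<length P. \<forall>a\<in>?R ! k. \<forall>b\<in>?R ! k. fs a = fs b) \<longleftrightarrow>
      (\<forall>k<length P. \<forall>a\<in>P ! k. \<forall>b\<in>P ! k. (fs \<circ> skip i) a = (fs \<circ> skip i) b)"
    by simp
  have pair: "(\<forall>a\<in>?R ! length P. \<forall>b\<in>?R ! length P. fs a = fs b) \<longleftrightarrow> fs i = fs (Suc i)"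
    by auto
  have less: "(\<forall>k<length P. \<forall>l<length P. k < l \<longrightarrow> (\<forall>a\<in>?R ! k. \<forall>b\<in>?R ! l. theta_le (fs a) (fs b))) \<longleftrightarrow>
      (\<forall>k<length P. \<forall>l<length P. k < l \<longrightarrow>
        (\<forall>a\<in>P ! k. \<forall>b\<in>P ! l. theta_le ((fs \<circ> skip i) a) ((fs \<circ> skip i) b)))"
    by simp
  have top: "(\<forall>k<length P. k < length P \<longrightarrow> (\<forall>a\<in>?R ! k. \<forall>b\<in>?R ! length P. theta_le (fs a) (fs b))) \<longleftrightarrow>
      (\<forall>k<length P. \<forall>a\<in>P ! k. theta_le (fs (skip i a)) (fs i) \<and> theta_le (fs (skip i a)) (fs (Suc i)))"
    by simp
  have none: "(\<forall>l<length P. length P < l \<longrightarrow> Z l) \<longleftrightarrow> True" for Z by auto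
  show ?thesis
    unfolding compatible_def all_less_insert_pair same pair none
    by (simp only: less top imp_conjR all_conj_distrib simp_thms less_irrefl conj_ac)
qed

definition partition_weight :: "(nat \<Rightarrow> real \<Rightarrow> complex) \<Rightarrow> nat set list \<Rightarrow> complex" where
  "partition_weight fs P = (\<Prod>k<length P. l2_inner (fs (Min (P!k))) (fs (Max (P!k))))"

lemma partition_weight_insert_pair:
  assumes "P \<in> MNC2 n"
  shows "partition_weight fs (insert_pair i P) =
    l2_inner (fs i) (fs (Suc i)) * partition_weight (fs \<circ> skip i) P"
proof -
  have "Min (skip i ` (P ! k)) = skip i (Min (P ! k))" "Max (skip i ` (P ! k)) = skip i (Max (P ! k))"
    if "k < length P" for k
  proof -
    have "card (P ! k) = 2" using that assms by (simp add: MNC2_def)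
    hence "finite (P ! k)" "P ! k \<noteq> {}" by (auto intro: card_ge_0_finite)
    thus "Min (skip i ` (P ! k)) = skip i (Min (P ! k))" "Max (skip i ` (P ! k)) = skip i (Max (P ! k))"
      using strict_mono_mono[OF strict_mono_skip] by (simp_all add: mono_Min_commute mono_Max_commute)
  qed
  thus ?thesis by (simp add: partition_weight_def mult.commute)
qed

definition compatible_MNC2 :: "nat \<Rightarrow> (nat \<Rightarrow> real \<Rightarrow> complex) \<Rightarrow> nat set list set" where
  "compatible_MNC2 n fs = {P \<in> MNC2 n. compatible P fs}"

text \<open>If the last block carried a letter other than \<open>chi s t\<close>, some block of
  smaller colour would carry \<open>chi s t\<close>, against the order. Conversely every letter of
  the family is at most \<open>chi s t\<close>, so appending a pair with this letter keeps
  compatibility.\<close>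

lemma compatible_MNC2_decompose:
  assumes "0 < n" "0 \<le> s" "s < t" "\<forall>j\<in>{1..n}. fs j \<in> Theta"
    and below: "\<forall>j\<in>{1..n}. fs j = chi s t \<or> below s (fs j)"
    and ex: "\<exists>j\<in>{1..n}. fs j = chi s t"
  shows "compatible_MNC2 n fs =
    (\<Union>i\<in>{i. 1 \<le> i \<and> Suc i \<le> n \<and> fs i = chi s t \<and> fs (Suc i) = chi s t}.
       insert_pair i ` compatible_MNC2 (n - 2) (fs \<circ> skip i))"
    (is "_ = ?U")
proof (rule subset_antisym; rule subsetI)
  fix P assume P: "P \<in> compatible_MNC2 n fs"
  then obtain i Q where iQ: "P = insert_pair i Q" "1 \<le> i" "Suc i \<le> n"
    using MNC2_last_block[of P n] assms(1) by (auto simp: compatible_MNC2_def)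
  have Q: "Q \<in> MNC2 (n - 2)" and c: "compatible (insert_pair i Q) fs"
    using P MNC2_insert_pair[OF iQ(2,3)] by (auto simp: compatible_MNC2_def iQ(1))
  obtain j where j: "j \<in> {1..n}" "fs j = chi s t" using ex by blast
  have "fs i = chi s t"
  proof (rule ccontr)
    assume ne: "fs i \<noteq> chi s t"
    hence "j \<in> {1..n} - {i, Suc i}" using j c by (auto simp: compatible_insert_pair)
    then obtain a where a: "j = skip i a" "a \<in> {1..n - 2}"
      using skip_image_interval[OF iQ(2,3)] by blast
    hence "a \<in> \<Union> (set Q)" using Q by (simp add: MNC2_def ordered_partition_def)
    then obtain k where "k < length Q" "a \<in> Q ! k" by (metis UnionE in_set_conv_nth)
    hence "theta_le (fs (skip i a)) (fs i)" using c by (auto simp: compatible_insert_pair)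
    hence "theta_le (chi s t) (fs i)" using a j by simp
    moreover have "below s (fs i)" using below ne iQ by auto
    ultimately show False using not_theta_le_chi_below[OF assms(3)] ne by blast
  qed
  moreover have "fs (Suc i) = fs i" "compatible Q (fs \<circ> skip i)"
    using c by (simp_all only: compatible_insert_pair)
  ultimately have "i \<in> {i. 1 \<le> i \<and> Suc i \<le> n \<and> fs i = chi s t \<and> fs (Suc i) = chi s t}"
    "Q \<in> compatible_MNC2 (n - 2) (fs \<circ> skip i)"
    using Q iQ(2,3) by (simp_all add: compatible_MNC2_def)
  thus "P \<in> ?U"
    using iQ(1) by blast
next
  fix P assume "P \<in> ?U"
  then obtain i Q where i: "1 \<le> i" "Suc i \<le> n" "fs i = chi s t" "fs (Suc i) = chi s t"
    and Q: "Q \<in> MNC2 (n - 2)" "compatible Q (fs \<circ> skip i)" "P = insert_pair i Q"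
    by (auto simp: compatible_MNC2_def)
  have "theta_le (fs (skip i a)) (chi s t)" if "k < length Q" "a \<in> Q ! k" for k a
  proof -
    have "Q ! k \<subseteq> \<Union> (set Q)" using that(1) by (intro Sup_upper nth_mem)
    also have "\<Union> (set Q) = {1..n - 2}" using Q(1) by (simp add: MNC2_def ordered_partition_def)
    finally have "a \<in> {1..n - 2}" using that(2) by blast
    hence "skip i a \<in> {1..n}" using skip_image_interval[OF i(1,2)] by blast
    hence "fs (skip i a) = chi s t \<or> theta_le (fs (skip i a)) (chi s t)"
      using below assms(4) theta_le_chi_below[OF assms(2,3)] by blast
    thus ?thesis by (auto simp: theta_le_def)
  qed
  hence "\<forall>k<length Q. \<forall>a\<in>Q ! k. theta_le (fs (skip i a)) (fs i) \<and> theta_le (fs (skip i a)) (fs (Suc i))"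
    unfolding i(3,4) by simp
  hence "compatible (insert_pair i Q) fs"
    unfolding compatible_insert_pair using Q(2) i(3,4) by (intro conjI) simp_all
  moreover have "insert_pair i Q \<in> MNC2 n"
    unfolding MNC2_insert_pair[OF i(1,2)] by (rule Q(1))
  ultimately show "P \<in> compatible_MNC2 n fs"
    unfolding Q(3) compatible_MNC2_def by simp
qed

lemma l2_inner_chi:
  assumes "0 \<le> s" "s < t"
  shows "l2_inner (chi s t) (chi s t) = of_real (t - s)"
proof -
  have "l2_inner (chi s t) (chi s t) = (LINT x|lborel. complex_of_real (indicator {s<..t} x))"
    unfolding l2_inner_def set_lebesgue_integral_def
    using assms by (intro Bochner_Integration.integral_cong) (auto simp: chi_def indicator_def)
  thus ?thesis using assms by simp
qed

text \<open>The decomposition is disjoint by \<open>insert_pair_inj\<close>, and each inserted pair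
  contributes the factor \<open>t - s\<close>, the squared norm of \<open>chi s t\<close>.\<close>

lemma sum_partition_weight_rec:
  assumes "0 < n" "0 \<le> s" "s < t" "\<forall>j\<in>{1..n}. fs j \<in> Theta"
    and "\<forall>j\<in>{1..n}. fs j = chi s t \<or> below s (fs j)"
    and "\<exists>j\<in>{1..n}. fs j = chi s t"
  shows "(\<Sum>P\<in>compatible_MNC2 n fs. partition_weight fs P) = of_real (t - s) *
    (\<Sum>i | 1 \<le> i \<and> Suc i \<le> n \<and> fs i = chi s t \<and> fs (Suc i) = chi s t.
       \<Sum>P\<in>compatible_MNC2 (n - 2) (fs \<circ> skip i). partition_weight (fs \<circ> skip i) P)"
proof -
  let ?I = "{i. 1 \<le> i \<and> Suc i \<le> n \<and> fs i = chi s t \<and> fs (Suc i) = chi s t}"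
  have fin: "finite (compatible_MNC2 k gs)" for k gs
    using finite_MNC2 by (simp add: compatible_MNC2_def)
  have "finite ?I" by (rule finite_subset[of _ "{..n}"]) auto
  hence "(\<Sum>P\<in>compatible_MNC2 n fs. partition_weight fs P) =
      (\<Sum>i\<in>?I. \<Sum>P\<in>insert_pair i ` compatible_MNC2 (n - 2) (fs \<circ> skip i). partition_weight fs P)"
    unfolding compatible_MNC2_decompose[OF assms]
    by (intro sum.UNION_disjoint) (auto simp: fin insert_pair_inj)
  also have "\<dots> = (\<Sum>i\<in>?I. \<Sum>P\<in>compatible_MNC2 (n - 2) (fs \<circ> skip i). partition_weight fs (insert_pair i P))"
    by (intro sum.cong refl sum.reindex_cong[OF _ refl]) (auto simp: inj_on_def insert_pair_inj)
  also have "\<dots> = (\<Sum>i\<in>?I. \<Sum>P\<in>compatible_MNC2 (n - 2) (fs \<circ> skip i).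
      of_real (t - s) * partition_weight (fs \<circ> skip i) P)"
    by (intro sum.cong refl)
       (auto simp: compatible_MNC2_def partition_weight_insert_pair l2_inner_chi[OF assms(2,3)])
  finally show ?thesis by (simp add: sum_distrib_left)
qed

section \<open>Comparison of the recursions\<close>

lemma count_list_remove_pair:
  assumes "Suc i < length w" "w ! i = f" "w ! Suc i = f"
  shows "count_list w g = count_list (take i w @ drop (Suc (Suc i)) w) g + (if g = f then 2 else 0)"
proof -
  have "w = take i w @ f # f # drop (Suc (Suc i)) w"
    using assms by (metis Cons_nth_drop_Suc Suc_lessD append_take_drop_id)
  hence "count_list w g = count_list (take i w @ f # f # drop (Suc (Suc i)) w) g" by simp
  thus ?thesis by (simp add: count_list_append)
qed

text \<open>List entries are numbered from \<open>0\<close> and positions from \<open>1\<close>,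
  hence \<open>skip (Suc i)\<close> for the deletion of entries \<open>i\<close> and
  \<open>Suc i\<close>.\<close>

lemma map_skip_eq:
  assumes "Suc i < n"
  shows "map (fs \<circ> skip (Suc i)) [1..<Suc (n - 2)] =
    take i (map fs [1..<Suc n]) @ drop (Suc (Suc i)) (map fs [1..<Suc n])"
  using assms by (intro nth_equalityI) (auto simp: nth_append skip_def simp del: upt_Suc)

text \<open>This is \<open>b_1! ... b_p!\<close> when all counts are even. The rounding for odd
  counts is harmless, since both sides of the moment formula then vanish.\<close>

definition multiplicity_factor :: "'a list \<Rightarrow> nat" where
  "multiplicity_factor w = (\<Prod>g\<in>set w. fact (count_list w g div 2))"

lemma multiplicity_factor_superset:
  assumes "finite S" "set w \<subseteq> S"
  shows "multiplicity_factor w = (\<Prod>g\<in>S. fact (count_list w g div 2))"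
  unfolding multiplicity_factor_def
  by (rule prod.mono_neutral_left) (use assms in \<open>auto simp: count_list_0_iff\<close>)

text \<open>Only the factorial belonging to \<open>f\<close> changes. The letter \<open>f\<close>
  may disappear from the shortened word, so both products are taken over the letters of
  \<open>w\<close>, absent letters contributing \<open>fact 0\<close>.\<close>

lemma multiplicity_factor_remove_pair:
  assumes i: "Suc i < length w" "w ! i = f" "w ! Suc i = f"
  shows "multiplicity_factor w =
    (count_list w f div 2) * multiplicity_factor (take i w @ drop (Suc (Suc i)) w)"
proof -
  let ?w = "take i w @ drop (Suc (Suc i)) w"
  have f: "f \<in> set w" using i by (metis Suc_lessD nth_mem)
  have sub: "set ?w \<subseteq> set w" by (auto dest: in_set_takeD in_set_dropD)
  have cf: "count_list w f = Suc (Suc (count_list ?w f))"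
    using count_list_remove_pair[OF i, of f] by simp
  have "multiplicity_factor w = fact (count_list w f div 2) *
      (\<Prod>g\<in>set w - {f}. fact (count_list w g div 2))"
    unfolding multiplicity_factor_def using f by (simp add: prod.remove)
  also have "fact (count_list w f div 2) = (count_list w f div 2) * fact (count_list ?w f div 2)"
    unfolding cf by simp
  also have "(\<Prod>g\<in>set w - {f}. fact (count_list w g div 2)) =
      (\<Prod>g\<in>set w - {f}. fact (count_list ?w g div 2))"
    by (intro prod.cong refl) (use count_list_remove_pair[OF i] in auto)
  finally show ?thesis
    unfolding multiplicity_factor_superset[OF finite_set sub]
    using f by (simp add: prod.remove[of "set w" f] mult.assoc)
qed

section \<open>Families with equal or disjoint supports\<close>

definition orthogonal_family :: "nat \<Rightarrow> (nat \<Rightarrow> real \<Rightarrow> complex) \<Rightarrow> bool" where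
  "orthogonal_family n fs \<longleftrightarrow> (\<forall>j\<in>{1..n}. fs j \<in> Theta) \<and>
     (\<forall>j\<in>{1..n}. \<forall>l\<in>{1..n}. fs j = fs l \<or> {x. fs j x \<noteq> 0} \<inter> {x. fs l x \<noteq> 0} = {})"

lemma orthogonal_family_skip:
  assumes "orthogonal_family n fs" "1 \<le> i" "Suc i \<le> n"
  shows "orthogonal_family (n - 2) (fs \<circ> skip i)"
proof -
  have "skip i j \<in> {1..n}" if "j \<in> {1..n - 2}" for j
    using skip_image_interval[OF assms(2,3)] that by blast
  thus ?thesis using assms(1) unfolding orthogonal_family_def comp_def by blast
qed

text \<open>Take the letter \<open>fs m\<close> with the greatest right endpoint. A letter that does
  not vanish beyond \<open>a m\<close> does so at a point no larger than \<open>b m\<close>, hence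
  meets the support of \<open>fs m\<close> and equals it.\<close>

lemma orthogonal_family_top:
  assumes "orthogonal_family n fs" "0 < n"
  obtains s t where "0 \<le> s" "s < t" "\<exists>j\<in>{1..n}. fs j = chi s t"
    "\<forall>j\<in>{1..n}. fs j = chi s t \<or> below s (fs j)"
proof -
  have "\<forall>j\<in>{1..n}. \<exists>a b. fs j = chi a b \<and> 0 \<le> a \<and> a < b"
    using assms(1) by (auto simp: orthogonal_family_def Theta_def)
  then obtain a b where ab: "\<And>j. j \<in> {1..n} \<Longrightarrow> fs j = chi (a j) (b j) \<and> 0 \<le> a j \<and> a j < b j"
    by metis
  have "finite (b ` {1..n})" "b ` {1..n} \<noteq> {}" using assms(2) by auto
  from Max_in[OF this] obtain m where m: "m \<in> {1..n}" "b m = Max (b ` {1..n})" by auto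
  have le: "b j \<le> b m" if "j \<in> {1..n}" for j using that m by simp
  have "fs j = fs m \<or> below (a m) (fs j)" if j: "j \<in> {1..n}" for j
  proof (rule disjCI)
    assume "\<not> below (a m) (fs j)"
    then obtain x where "a m < x" "a j < x" "x \<le> b j"
      using ab[OF j] by (auto simp: below_def chi_def indicator_def split: if_splits)
    hence "x \<in> {x. fs j x \<noteq> 0} \<inter> {x. fs m x \<noteq> 0}"
      using ab[OF j] ab[OF m(1)] le[OF j] by (simp add: chi_def indicator_def)
    thus "fs j = fs m" using assms(1) j m(1) unfolding orthogonal_family_def by blast
  qed
  thus ?thesis using that[of "a m" "b m"] ab[OF m(1)] m(1) by metis
qed

text \<open>Both sides obey the recursion that deletes pairs of the top letter; the factor
  \<open>k/2\<close> on the moment side is absorbed by \<open>multiplicity_factor\<close>. The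
  parity statement is carried along because \<open>k div 2\<close> agrees with \<open>k/2\<close>
  only for even \<open>k\<close>.\<close>

lemma sum_partition_weight_eq_word_moment:
  assumes "orthogonal_family n fs"
  shows "(\<Sum>P\<in>compatible_MNC2 n fs. partition_weight fs P) =
      of_nat (multiplicity_factor (map fs [1..<Suc n])) * word_moment (map fs [1..<Suc n]) \<and>
    (\<forall>g. odd (count_list (map fs [1..<Suc n]) g) \<longrightarrow> word_moment (map fs [1..<Suc n]) = 0)"
  using assms
proof (induction n arbitrary: fs rule: less_induct)
  case (less n)
  let ?w = "map fs [1..<Suc n]"
  let ?M = "\<lambda>n fs. \<Sum>P\<in>compatible_MNC2 n fs. partition_weight fs P"
  note orth = less.prems
  show ?case
  proof (cases "n = 0")
    case True
    have "MNC2 0 = {[]}"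
    proof (intro set_eqI iffI)
      fix P assume "P \<in> MNC2 0"
      thus "P \<in> {[]}" by (cases P) (auto simp: MNC2_def ordered_partition_def)
    qed (auto simp: MNC2_def ordered_partition_def noncrossing_def)
    moreover have "compatible [] fs" by (simp add: compatible_def)
    ultimately have "compatible_MNC2 n fs = {[]}"
      unfolding compatible_MNC2_def \<open>n = 0\<close> by blast
    thus ?thesis using True
      by (simp add: partition_weight_def multiplicity_factor_def word_moment_def vacuum_def)
  next
    case False
    hence n: "0 < n" and "n - 2 < n" by simp_all
    obtain s t where st: "0 \<le> s" "s < t" and ex: "\<exists>j\<in>{1..n}. fs j = chi s t"
      and below: "\<forall>j\<in>{1..n}. fs j = chi s t \<or> below s (fs j)"
      using orthogonal_family_top[OF orth n] by metis
    define f where "f = chi s t"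
    define L where "L = complex_of_real (t - s)"
    define I where "I = {i. Suc i < length ?w \<and> ?w ! i = f \<and> ?w ! Suc i = f}"
    define rem where "rem = (\<lambda>i. take i ?w @ drop (Suc (Suc i)) ?w)"
    have setw: "set ?w = fs ` {1..n}" by (auto simp del: upt_Suc)
    have fw: "f \<in> set ?w" using ex unfolding setw f_def by force
    hence cpos: "count_list ?w f \<noteq> 0" by (simp add: count_list_0_iff)
    have I: "Suc i < n" "fs (Suc i) = f" "fs (Suc (Suc i)) = f" "Suc i < length ?w"
        "?w ! i = f" "?w ! Suc i = f" if "i \<in> I" for i
      using that by (auto simp: I_def simp del: upt_Suc)
    have rem: "map (fs \<circ> skip (Suc i)) [1..<Suc (n - 2)] = rem i"
      and orth': "orthogonal_family (n - 2) (fs \<circ> skip (Suc i))" if "i \<in> I" for i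
      using map_skip_eq[of i n fs] orthogonal_family_skip[OF orth, of "Suc i"] I[OF that]
      by (simp_all add: rem_def del: upt_Suc)
    have IH: "?M (n - 2) (fs \<circ> skip (Suc i)) = of_nat (multiplicity_factor (rem i)) * word_moment (rem i)"
      "odd (count_list (rem i) g) \<Longrightarrow> word_moment (rem i) = 0" if "i \<in> I" for i g
      using less.IH[OF \<open>n - 2 < n\<close> orth'[OF that]] unfolding rem[OF that] by blast+
    have "?M n fs = L * (\<Sum>i | 1 \<le> i \<and> Suc i \<le> n \<and> fs i = f \<and> fs (Suc i) = f. ?M (n - 2) (fs \<circ> skip i))"
      unfolding f_def L_def using orth
      by (intro sum_partition_weight_rec n st below ex) (simp add: orthogonal_family_def)
    also have "(\<Sum>i | 1 \<le> i \<and> Suc i \<le> n \<and> fs i = f \<and> fs (Suc i) = f. ?M (n - 2) (fs \<circ> skip i)) =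
        (\<Sum>i\<in>I. ?M (n - 2) (fs \<circ> skip (Suc i)))"
      by (rule sum.reindex_bij_witness[where i = Suc and j = "\<lambda>i. i - 1"])
         (auto simp: I_def simp del: upt_Suc)
    also have "\<dots> = (\<Sum>i\<in>I. of_nat (multiplicity_factor (rem i)) * word_moment (rem i))"
      by (intro sum.cong refl IH)
    finally have M: "?M n fs = L * (\<Sum>i\<in>I. of_nat (multiplicity_factor (rem i)) * word_moment (rem i))" .
    have "\<forall>g\<in>set ?w. g = chi s t \<or> below s g" using below unfolding setw by blast
    from word_moment_pair_removals[OF st this]
    have F: "of_nat (count_list ?w f) / 2 * word_moment ?w = L * (\<Sum>i\<in>I. word_moment (rem i))"
      unfolding sum_list_pair_removals f_def[symmetric] L_def[symmetric] I_def rem_def .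
    show ?thesis
    proof (cases "\<exists>g. odd (count_list ?w g)")
      case True
      then obtain g where g: "odd (count_list ?w g)" by blast
      \<comment> \<open>A deletion changes each count by \<open>0\<close> or \<open>2\<close>, so
        \<open>g\<close> still occurs an odd number of times in the shortened word.\<close>
      have z: "word_moment (rem i) = 0" if "i \<in> I" for i
        using that g count_list_remove_pair[OF I(4-6)[OF that], of g]
        by (intro IH(2)[of i g]) (auto simp: rem_def split: if_splits)
      hence "of_nat (count_list ?w f) / 2 * word_moment ?w = 0" unfolding F by simp
      hence "word_moment ?w = 0" using cpos by (simp del: upt_Suc)
      moreover have "?M n fs = 0" unfolding M using z by simp
      ultimately show ?thesis by simp
    next
      case False
      hence "even (count_list ?w f)" by blast
      \<comment> \<open>Evenness makes the integer factor split off from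
        \<open>multiplicity_factor\<close> equal to the factor in \<open>F\<close>.\<close>
      hence "complex_of_nat (count_list ?w f div 2) = of_nat (count_list ?w f) / 2"
        by (auto elim!: evenE simp del: upt_Suc)
      hence "of_nat (multiplicity_factor ?w) * word_moment (rem i) =
          of_nat (count_list ?w f) / 2 * (of_nat (multiplicity_factor (rem i)) * word_moment (rem i))"
        if "i \<in> I" for i
        unfolding multiplicity_factor_remove_pair[OF I(4-6)[OF that]] rem_def by (simp del: upt_Suc)
      hence mult: "of_nat (multiplicity_factor ?w) * (\<Sum>i\<in>I. word_moment (rem i)) = of_nat (count_list ?w f) / 2 *
          (\<Sum>i\<in>I. of_nat (multiplicity_factor (rem i)) * word_moment (rem i))"
        unfolding sum_distrib_left by (intro sum.cong refl)
      have "of_nat (count_list ?w f) / 2 * ?M n fs =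
          L * (of_nat (multiplicity_factor ?w) * (\<Sum>i\<in>I. word_moment (rem i)))"
        unfolding M mult by (rule mult.left_commute)
      also have "\<dots> = of_nat (multiplicity_factor ?w) * (L * (\<Sum>i\<in>I. word_moment (rem i)))"
        by (rule mult.left_commute)
      also have "\<dots> = of_nat (count_list ?w f) / 2 * (of_nat (multiplicity_factor ?w) * word_moment ?w)"
        unfolding F[symmetric] by (rule mult.left_commute)
      finally have "?M n fs = of_nat (multiplicity_factor ?w) * word_moment ?w"
        by (rule mult_left_cancel[THEN iffD1, rotated]) (use cpos in \<open>simp del: upt_Suc\<close>)
      thus ?thesis using False by blast
    qed
  qed
qed

lemma prod_fact_blocks_eq_multiplicity_factor:
  fixes fs :: "nat \<Rightarrow> 'a"
  shows "(\<Prod>B\<in>{{l \<in> {1..n}. fs l = fs j} | j. j \<in> {1..n}}. fact (card B div 2)) =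
    multiplicity_factor (map fs [1..<Suc n])"
proof -
  let ?B = "\<lambda>g. {l \<in> {1..n}. fs l = g}"
  have "{{l \<in> {1..n}. fs l = fs j} | j. j \<in> {1..n}} = ?B ` fs ` {1..n}" by auto
  \<comment> \<open>Blocks correspond to letters: the fibre over an attained letter is nonempty and
    hence determines it.\<close>
  moreover have "inj_on ?B (fs ` {1..n})" 
  proof (rule inj_onI)
    fix g h assume "g \<in> fs ` {1..n}" and eq: "?B g = ?B h"
    then obtain j where "j \<in> ?B g" by blast
    hence "j \<in> ?B g" "j \<in> ?B h" unfolding eq by simp_all
    thus "g = h" by simp
  qed
  moreover have "card (?B g) = count_list (map fs [1..<Suc n]) g" for g
  proof -
    have "{l \<in> {1..n}. fs l = g} = set (filter (\<lambda>l. fs l = g) [1..<Suc n])"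
      by (auto simp del: upt_Suc)
    hence "card (?B g) = length (filter (\<lambda>l. fs l = g) [1..<Suc n])"
      by (simp only: distinct_card distinct_filter distinct_upt)
    moreover have "(\<lambda>l. fs l = g) = (=) g \<circ> fs" by (auto simp: fun_eq_iff)
    ultimately show ?thesis by (simp only: count_list_eq_length_filter filter_map length_map)
  qed
  moreover have "set (map fs [1..<Suc n]) = fs ` {1..n}" by (auto simp del: upt_Suc)
  ultimately show ?thesis
    unfolding multiplicity_factor_def by (simp add: prod.reindex del: upt_Suc)
qed

theorem theorem10p3:
  fixes n :: nat and fs :: "nat \<Rightarrow> real \<Rightarrow> complex"
  assumes inTheta: "\<forall>j\<in>{1..n}. fs j \<in> Theta"
    and supp: "\<forall>j\<in>{1..n}. \<forall>l\<in>{1..n}.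
                 fs j = fs l \<or> {x. fs j x \<noteq> 0} \<inter> {x. fs l x \<noteq> 0} = {}"
  defines "\<sigma> \<equiv> {{l \<in> {1..n}. fs l = fs j} | j. j \<in> {1..n}}"
  shows "vac_moment fs n =
     (1 / of_nat (\<Prod>B\<in>\<sigma>. fact (card B div 2))) *
     (\<Sum>P\<in>{P \<in> MNC2 n. compatible P fs}.
        \<Prod>k<length P. l2_inner (fs (Min (P!k))) (fs (Max (P!k))))"
proof -
  let ?w = "map fs [1..<Suc n]"
  have "orthogonal_family n fs" using inTheta supp by (simp add: orthogonal_family_def)
  from sum_partition_weight_eq_word_moment[OF this]
  have "(\<Sum>P\<in>{P \<in> MNC2 n. compatible P fs}.
        \<Prod>k<length P. l2_inner (fs (Min (P!k))) (fs (Max (P!k)))) =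
      of_nat (multiplicity_factor ?w) * vac_moment fs n"
    by (simp only: compatible_MNC2_def partition_weight_def vac_moment_def word_moment_def)
  moreover have "multiplicity_factor ?w \<noteq> 0" by (simp add: multiplicity_factor_def del: upt_Suc)
  ultimately show ?thesis
    unfolding \<sigma>_def prod_fact_blocks_eq_multiplicity_factor by (simp del: upt_Suc)
qed

end
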